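(* Let $x,y$ be involutions in $S_n$ and $w\in S_n$. Then $w\in\mathcal{A}(x,y)$ if and only if, for all $(a,b),(a',b')\in\mathrm{Cyc}(y)$, the following hold: 1. If $w(a)<w(b)$ then $(w(a),w(b))\in\mathrm{Cyc}(x)$, and otherwise $\{w(a),w(b)\}\subset\mathrm{Fix}(x)$. 2. If $a\leq b<a'\leq b'$ then $w(a)<w(a')$, $w(a)<w(b')$, $w(b)<w(b')$ and $w(b)<w(a')$. 3. If $a<a'<b<b'$ then $w(a)<w(a')$, $w(a)<w(b')$ and $w(b)<w(b')$. 4. If $a<a'<b'<b$ then neither $w(b)<w(a')<w(a)$ nor $w(b)<w(b')<w(a)$ occurs, and neither $w(a')<w(a)<w(b)<w(b')$ nor $w(a')<w(b)\leq w(a)<w(b')$ occurs. 5. If $a<a'=b'<b$ then it does not occur that $w(b)<w(a')=w(b')<w(a)$.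
   Context: $S_n$ is the Coxeter group with simple generators $s_i=(i,i+1)$ and length $\ell$. The Demazure product $\circ$ is the unique associative operation on $S_n$ with $s\circ w = sw$ if $\ell(sw)>\ell(w)$ and $s\circ w=w$ otherwise, and $w\circ s=ws$ if $\ell(ws)>\ell(w)$ and $w\circ s = w$ otherwise. For involutions $x,y\in S_n$, $\mathcal{A}(x,y)$ is the set of minimal-length elements of $\{w\in S_n: w^{-1}\circ x\circ w=y\}$. For an involution $y$, $\mathrm{Cyc}(y)=\{(a,b)\in[n]\times[n]: a\leq b=y(a)\}$ and $\mathrm{Fix}(y)=\{a\in[n]: y(a)=a\}$. *)

theory Defs
  imports "HOL-Combinatorics.Permutations" "HOL-Library.FuncSet"
begin

(* S_n is the set of functions on nat that permute {1..n} (and fix every other number);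
   the group product u v is the composition u o v, so (u v)(i) = u (v i). *)

definition Sym :: "nat \<Rightarrow> (nat \<Rightarrow> nat) set" where
  "Sym n = {w. w permutes {1..n}}"

definition simple_gen :: "nat \<Rightarrow> nat \<Rightarrow> nat" where
  "simple_gen i = transpose i (i + 1)"

definition simple_gens :: "nat \<Rightarrow> (nat \<Rightarrow> nat) set" where
  "simple_gens n = simple_gen ` {1..<n}"

definition word_prod :: "(nat \<Rightarrow> nat) list \<Rightarrow> nat \<Rightarrow> nat" where
  "word_prod ss = foldr (\<circ>) ss id"

definition len :: "nat \<Rightarrow> (nat \<Rightarrow> nat) \<Rightarrow> nat" where
  "len n w = (LEAST k. \<exists>ss. length ss = k \<and> set ss \<subseteq> simple_gens n \<and> word_prod ss = w)"

(* The unit law is part of the usual convention (the Demazure product makes S_n a monoid).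
   It has to be stated: for n = 2 the constant operation with value s_1 satisfies all the
   other conditions, so without it uniqueness would fail. *)
definition is_demazure_product ::
  "nat \<Rightarrow> ((nat \<Rightarrow> nat) \<times> (nat \<Rightarrow> nat) \<Rightarrow> nat \<Rightarrow> nat) \<Rightarrow> bool" where
  "is_demazure_product n m \<longleftrightarrow>
     (\<forall>u\<in>Sym n. \<forall>v\<in>Sym n. \<forall>w\<in>Sym n. m (m (u, v), w) = m (u, m (v, w))) \<and>
     (\<forall>w\<in>Sym n. m (id, w) = w \<and> m (w, id) = w) \<and>
     (\<forall>s\<in>simple_gens n. \<forall>w\<in>Sym n.
        m (s, w) = (if len n (s \<circ> w) > len n w then s \<circ> w else w) \<and>
        m (w, s) = (if len n (w \<circ> s) > len n w then w \<circ> s else w))"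

(* The extensional function space makes the operation unique as a HOL function,
   by fixing its value outside S_n x S_n. *)
definition demazure :: "nat \<Rightarrow> (nat \<Rightarrow> nat) \<Rightarrow> (nat \<Rightarrow> nat) \<Rightarrow> nat \<Rightarrow> nat" where
  "demazure n u v =
     (THE m. m \<in> (Sym n \<times> Sym n) \<rightarrow>\<^sub>E Sym n \<and> is_demazure_product n m) (u, v)"

(* The identity counts as an involution. *)
definition Invol :: "nat \<Rightarrow> (nat \<Rightarrow> nat) set" where
  "Invol n = {y \<in> Sym n. y \<circ> y = id}"

definition demazure_conjugators :: "nat \<Rightarrow> (nat \<Rightarrow> nat) \<Rightarrow> (nat \<Rightarrow> nat) \<Rightarrow> (nat \<Rightarrow> nat) set" where
  "demazure_conjugators n x y = {w \<in> Sym n. demazure n (demazure n (inv w) x) w = y}"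

definition atoms :: "nat \<Rightarrow> (nat \<Rightarrow> nat) \<Rightarrow> (nat \<Rightarrow> nat) \<Rightarrow> (nat \<Rightarrow> nat) set" where
  "atoms n x y = {w \<in> demazure_conjugators n x y.
     \<forall>v \<in> demazure_conjugators n x y. len n w \<le> len n v}"

definition Cyc :: "nat \<Rightarrow> (nat \<Rightarrow> nat) \<Rightarrow> (nat \<times> nat) set" where
  "Cyc n y = {(a, b) \<in> {1..n} \<times> {1..n}. a \<le> b \<and> b = y a}"

definition Fix :: "nat \<Rightarrow> (nat \<Rightarrow> nat) \<Rightarrow> nat set" where
  "Fix n y = {a \<in> {1..n}. y a = a}"

end

theory Submission
  imports Defs
begin

text \<open>
  Reading a word in the simple generators as a sequence of moves \<open>w \<mapsto> w \<circ> s\<close> (the Demazure product with \<open>s\<close>)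
  turns the Demazure product into concatenation of words. This gives its existence and shows that
  appending an ascent \<open>s\<close> to \<open>w\<close> changes \<open>z = w\<^sup>-\<^sup>1 \<circ> x \<circ> w\<close> into \<open>s \<circ> z \<circ> s\<close>, which is \<open>z\<close>, \<open>zs\<close> or \<open>szs\<close>.
  If it is not \<open>z\<close>, then the rank of the involution goes up by one; hence \<open>w\<close> is an atom exactly if
  all moves of a reduced word of \<open>w\<close> are proper. The pattern conditions obey the same recursion: if they hold
  and \<open>i\<close> is a descent of \<open>w\<close>, then \<open>i\<close> is a descent of \<open>y\<close>, and undoing the move \<open>s\<^sub>i\<close> in \<open>w\<close> and \<open>y\<close>
  only affects the conditions on the at most two cycles of \<open>y\<close> through \<open>i\<close> and \<open>i + 1\<close>.
\<close>

section \<open>Adjacent transpositions and the group of permutations of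
  \<open>{1..n}\<close>\<close>

abbreviation "sg \<equiv> simple_gen"

text \<open>No number lies strictly between \<open>i\<close> and \<open>Suc i\<close>, so swapping
  them reverses this one comparison and preserves all others.\<close>

lemma sg_less_iff:
  "\<not> (a = i \<and> b = Suc i) \<Longrightarrow> \<not> (a = Suc i \<and> b = i) \<Longrightarrow> sg i a < sg i b \<longleftrightarrow> a < b"
  by (auto simp: simple_gen_def transpose_def)

lemma sg_simps [simp]:
  "sg i i = Suc i" "sg i (Suc i) = i" "u \<noteq> i \<Longrightarrow> u \<noteq> Suc i \<Longrightarrow> sg i u = u"
  "sg i (sg i u) = u" "sg i \<circ> sg i = id" "inv (sg i) = sg i" "bij (sg i)"
  by (auto simp: simple_gen_def)

lemma sg_eq_iff [simp]: "sg i a = sg i b \<longleftrightarrow> a = b"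
  by (metis sg_simps(4))

lemma comp_sg_sg [simp]: "w \<circ> sg i \<circ> sg i = w"
  by (simp add: comp_assoc)

lemma sg_in_Sym: "i \<in> {1..<n} \<Longrightarrow> sg i \<in> Sym n"
  by (auto simp: simple_gen_def Sym_def intro: permutes_swap_id)

lemma Sym_comp: "u \<in> Sym n \<Longrightarrow> v \<in> Sym n \<Longrightarrow> u \<circ> v \<in> Sym n"
  by (auto simp: Sym_def intro: permutes_compose)

lemma id_in_Sym [simp]: "id \<in> Sym n"
  by (simp add: Sym_def permutes_id)

lemma Sym_inv: "w \<in> Sym n \<Longrightarrow> inv w \<in> Sym n"
  by (simp add: Sym_def permutes_inv)

lemma Sym_bij: "w \<in> Sym n \<Longrightarrow> bij w"
  by (auto simp: Sym_def permutes_bij)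

text \<open>Strict growth from \<open>w 1 >= 1\<close> gives \<open>k <= w k\<close> throughout, and
  a permutation of \<open>{1..n}\<close> that never decreases a number is the identity.\<close>

lemma Sym_id_if_ascending:
  assumes w: "w \<in> Sym n" and asc: "\<And>i. i \<in> {1..<n} \<Longrightarrow> w i < w (Suc i)"
  shows "w = id"
proof -
  have p: "w permutes {1..n}" using w by (simp add: Sym_def)
  have "k \<le> n \<longrightarrow> k \<le> w k" for k
  proof (induction k)
    case (Suc k)
    show ?case
    proof (cases "k = 0")
      case True
      then show ?thesis using permutes_in_image[OF p, of 1] by auto
    next
      case False
      then show ?thesis using Suc asc[of k] by auto
    qed
  qed simp
  then show ?thesis using permutes_natset_ge[OF p] by auto
qed

subsection \<open>Inversions and length\<close>

definition inversions :: "(nat \<Rightarrow> nat) \<Rightarrow> (nat \<times> nat) set" where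
  "inversions w = {(a, b). a < b \<and> w b < w a}"

lemma inversions_id [simp]: "inversions id = {}"
  by (auto simp: inversions_def)

text \<open>Inversions are taken over all of \<open>nat\<close>, but \<open>w\<close> fixes 0 and
  everything above \<open>n\<close>, so no such point can take part in one.\<close>

lemma finite_inversions: "w \<in> Sym n \<Longrightarrow> finite (inversions w)"
proof (rule finite_subset)
  assume "w \<in> Sym n"
  then have p: "w permutes {1..n}" by (simp add: Sym_def)
  show "inversions w \<subseteq> {1..n} \<times> {1..n}"
  proof (rule subrelI)
    fix a b assume "(a, b) \<in> inversions w"
    then have ab: "a < b" "w b < w a" by (auto simp: inversions_def)
    have fix0: "w k = k" if "k \<notin> {1..n}" for k using p that by (simp add: permutes_def)
    have "w k \<in> {1..n}" if "k \<in> {1..n}" for k using permutes_in_image[OF p] that by blast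
    then have wn: "w k \<le> n" if "k \<le> n" for k
      using that fix0 by (metis atLeastAtMost_iff)
    have "a \<noteq> 0" using ab fix0[of 0] by (cases a) auto
    moreover have "b \<le> n" using ab fix0[of b] fix0[of a] wn[of a] by force
    ultimately show "(a, b) \<in> {1..n} \<times> {1..n}" using ab by auto
  qed
qed simp

text \<open>Exchanging two adjacent positions relabels the old inversions and creates one new
  inversion, the exchanged pair itself.\<close>

lemma inversions_comp_sg:
  assumes "w i < w (Suc i)"
  shows "inversions (w \<circ> sg i) = insert (i, Suc i) (map_prod (sg i) (sg i) ` inversions w)"
proof (intro set_eqI iffI; clarify)
  fix a b assume ab: "(a, b) \<in> inversions (w \<circ> sg i)" 
    and no: "(a, b) \<notin> map_prod (sg i) (sg i) ` inversions w"
  show "a = i \<and> b = Suc i"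
  proof (rule ccontr)
    assume "\<not> ?thesis"
    with ab have "sg i a < sg i b" by (subst sg_less_iff) (auto simp: inversions_def)
    with ab have "(sg i a, sg i b) \<in> inversions w" by (auto simp: inversions_def)
    with no show False by (metis imageI map_prod_simp sg_simps(4))
  qed
next
  fix a b assume "(a, b) \<in> insert (i, Suc i) (map_prod (sg i) (sg i) ` inversions w)"
  then consider "a = i" "b = Suc i" | c d where "(c, d) \<in> inversions w" "a = sg i c" "b = sg i d"
    by auto
  then show "(a, b) \<in> inversions (w \<circ> sg i)"
  proof cases
    case 2
    then have "sg i c < sg i d" using assms by (subst sg_less_iff) (auto simp: inversions_def)
    then show ?thesis using 2 by (auto simp: inversions_def)
  qed (use assms in \<open>auto simp: inversions_def\<close>)
qed

lemma card_inversions_comp_sg: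
  assumes "w \<in> Sym n" "w i < w (Suc i)"
  shows "card (inversions (w \<circ> sg i)) = Suc (card (inversions w))"
proof -
  have "inj (map_prod (sg i) (sg i))" by (auto intro!: injI)
  then have "card (map_prod (sg i) (sg i) ` inversions w) = card (inversions w)"
    by (meson card_image inj_on_subset subset_UNIV)
  \<comment> \<open>A preimage would be the pair \<open>(Suc i, i)\<close>, which is not
    increasing.\<close>
  moreover have "(i, Suc i) \<notin> map_prod (sg i) (sg i) ` inversions w"
  proof
    assume "(i, Suc i) \<in> map_prod (sg i) (sg i) ` inversions w"
    then obtain c d where cd: "c < d" "sg i c = i" "sg i d = Suc i" by (auto simp: inversions_def)
    then have "c = Suc i" "d = i" by (metis sg_simps)+
    with cd show False by simp
  qed
  ultimately show ?thesis
    by (simp add: inversions_comp_sg[OF assms(2)] finite_inversions[OF assms(1)])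
qed

lemma Sym_neq_Suc: "w \<in> Sym n \<Longrightarrow> w i \<noteq> w (Suc i)"
  by (metis Sym_bij bij_pointE n_not_Suc_n)

text \<open>A permutation other than \<open>id\<close> has a descent, and removing it lowers the
  number of inversions. This is induction along a reduced word, with letters appended on the
  right.\<close>

lemma Sym_induct [consumes 1, case_names id step]:
  assumes "w \<in> Sym n" and "P id"
    and step: "\<And>w i. w \<in> Sym n \<Longrightarrow> i \<in> {1..<n} \<Longrightarrow> w i < w (Suc i) \<Longrightarrow> P w \<Longrightarrow> P (w \<circ> sg i)"
  shows "P w"
  using assms(1)
proof (induction "card (inversions w)" arbitrary: w rule: less_induct)
  case less
  show ?case
  proof (cases "\<forall>i\<in>{1..<n}. w i < w (Suc i)")
    case True
    then show ?thesis using Sym_id_if_ascending[OF less.prems] \<open>P id\<close> by auto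
  next
    case False
    then obtain i where i: "i \<in> {1..<n}" "w (Suc i) < w i"
      using Sym_neq_Suc[OF less.prems] by (metis linorder_neqE_nat)
    let ?v = "w \<circ> sg i"
    have v: "?v \<in> Sym n" "?v i < ?v (Suc i)"
      using less.prems i sg_in_Sym Sym_comp by auto
    then have "card (inversions ?v) < card (inversions w)"
      using card_inversions_comp_sg[of ?v n i, OF v] by simp
    then have "P ?v" using less.hyps[OF _ v(1)] by blast
    then show ?thesis using step[of ?v i, OF v(1) i(1) v(2)] by simp
  qed
qed

lemma card_inversions_comp_sg_le:
  assumes "w \<in> Sym n" "i \<in> {1..<n}"
  shows "card (inversions (w \<circ> sg i)) \<le> Suc (card (inversions w))"
proof (cases "w i < w (Suc i)")
  case False
  let ?v = "w \<circ> sg i"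
  have "?v \<in> Sym n" "?v i < ?v (Suc i)"
    using assms False Sym_neq_Suc[of w n i] sg_in_Sym Sym_comp by auto
  from card_inversions_comp_sg[of ?v n i, OF this] show ?thesis by simp
qed (use card_inversions_comp_sg assms in auto)

lemma word_prod_append: "word_prod (xs @ ys) = word_prod xs \<circ> word_prod ys"
  by (induction xs) (auto simp: word_prod_def comp_assoc)

text \<open>Building \<open>w\<close> by ascents gives a word with one letter per inversion;
  conversely, each letter of any word adds at most one inversion.\<close>

lemma len_eq_card_inversions:
  assumes "w \<in> Sym n"
  shows "len n w = card (inversions w)"
  unfolding len_def
proof (rule Least_equality)
  show "\<exists>ss. length ss = card (inversions w) \<and> set ss \<subseteq> simple_gens n \<and> word_prod ss = w"
    using assms
  proof (induction rule: Sym_induct)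
    case id
    show "\<exists>ss. length ss = card (inversions id) \<and> set ss \<subseteq> simple_gens n \<and> word_prod ss = id"
      by (intro exI[of _ "[]"]) (simp add: word_prod_def)
  next
    case (step w i)
    then obtain ss where "length ss = card (inversions w)" "set ss \<subseteq> simple_gens n" "word_prod ss = w"
      by blast
    moreover have "word_prod [sg i] = sg i" by (simp add: word_prod_def)
    ultimately show "\<exists>ss. length ss = card (inversions (w \<circ> sg i)) \<and>
        set ss \<subseteq> simple_gens n \<and> word_prod ss = w \<circ> sg i"
      using step(2) card_inversions_comp_sg[of w n i, OF step(1,3)]
      by (intro exI[of _ "ss @ [sg i]"]) (auto simp: word_prod_append simple_gens_def)
  qed
next
  fix k assume "\<exists>ss. length ss = k \<and> set ss \<subseteq> simple_gens n \<and> word_prod ss = w"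
  then obtain ss where ss: "length ss = k" "set ss \<subseteq> simple_gens n" "word_prod ss = w" by blast
  have "word_prod ss \<in> Sym n \<and> card (inversions (word_prod ss)) \<le> length ss"
    using ss(2)
  proof (induction ss rule: rev_induct)
    case Nil
    show "word_prod [] \<in> Sym n \<and> card (inversions (word_prod [])) \<le> length []"
      by (simp add: word_prod_def)
  next
    case (snoc s ss)
    then obtain i where i: "i \<in> {1..<n}" "s = sg i" by (auto simp: simple_gens_def)
    have "word_prod (ss @ [s]) = word_prod ss \<circ> sg i"
      by (simp add: i word_prod_append) (simp add: word_prod_def)
    moreover have IH: "word_prod ss \<in> Sym n" "card (inversions (word_prod ss)) \<le> length ss"
      using snoc by auto
    moreover have "word_prod ss \<circ> sg i \<in> Sym n"
      using IH(1) sg_in_Sym[OF i(1)] by (rule Sym_comp)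
    ultimately show "word_prod (ss @ [s]) \<in> Sym n \<and>
        card (inversions (word_prod (ss @ [s]))) \<le> length (ss @ [s])"
      using card_inversions_comp_sg_le[OF IH(1) i(1)] by simp
  qed
  with ss show "card (inversions w) \<le> k" by auto
qed

lemma len_id [simp]: "len n id = 0"
  by (simp add: len_eq_card_inversions)

lemma len_comp_sg: "w \<in> Sym n \<Longrightarrow> i \<in> {1..<n} \<Longrightarrow> w i < w (Suc i) \<Longrightarrow> len n (w \<circ> sg i) = Suc (len n w)"
  using Sym_comp sg_in_Sym by (simp add: len_eq_card_inversions card_inversions_comp_sg)

lemma len_comp_sg_gt_iff:
  assumes "w \<in> Sym n" "i \<in> {1..<n}"
  shows "len n w < len n (w \<circ> sg i) \<longleftrightarrow> w i < w (Suc i)"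
proof (cases "w i < w (Suc i)")
  case False
  let ?v = "w \<circ> sg i"
  have "?v \<in> Sym n" "?v i < ?v (Suc i)"
    using assms False Sym_neq_Suc[of w n i] sg_in_Sym Sym_comp by auto
  from len_comp_sg[of ?v n i, OF this(1) assms(2) this(2)] show ?thesis using False by simp
qed (use len_comp_sg assms in auto)

text \<open>Passing from the positions of an inversion of \<open>w\<close> to its values, in
  increasing order, gives an inversion of \<open>inv w\<close>, and this is reversible.\<close>

lemma len_inv:
  assumes w: "w \<in> Sym n"
  shows "len n (inv w) = len n w"
proof -
  have b: "bij w" using w by (rule Sym_bij)
  have "bij_betw (\<lambda>(a, b). (w b, w a)) (inversions w) (inversions (inv w))"
    by (rule bij_betw_byWitness[where f' = "\<lambda>(a, b). (inv w b, inv w a)"])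
      (use b in \<open>auto simp: inversions_def bij_is_inj bij_is_surj surj_f_inv_f\<close>)
  from bij_betw_same_card[OF this] show ?thesis
    using w Sym_inv by (simp add: len_eq_card_inversions)
qed

lemma inv_comp_sg: "w \<in> Sym n \<Longrightarrow> inv (w \<circ> sg i) = sg i \<circ> inv w"
  by (simp add: o_inv_distrib Sym_bij)

lemma inv_sg_comp: "w \<in> Sym n \<Longrightarrow> inv (sg i \<circ> w) = inv w \<circ> sg i"
  by (simp add: o_inv_distrib Sym_bij)

lemma len_sg_comp_gt_iff:
  assumes "w \<in> Sym n" "i \<in> {1..<n}"
  shows "len n w < len n (sg i \<circ> w) \<longleftrightarrow> inv w i < inv w (Suc i)"
proof -
  have "len n (sg i \<circ> w) = len n (inv w \<circ> sg i)"
    using assms len_inv[of "sg i \<circ> w" n] inv_sg_comp Sym_comp sg_in_Sym by auto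
  then show ?thesis using len_comp_sg_gt_iff[of "inv w" n i] assms Sym_inv len_inv by metis
qed

subsection \<open>The Demazure product\<close>

text \<open>Right multiplication by a generator of the 0-Hecke monoid, with ascents read off from
  values instead of from \<open>len\<close>.\<close>

definition right_act :: "nat \<Rightarrow> (nat \<Rightarrow> nat) \<Rightarrow> nat \<Rightarrow> nat" where
  "right_act i w = (if w i < w (Suc i) then w \<circ> sg i else w)"

definition left_act :: "nat \<Rightarrow> (nat \<Rightarrow> nat) \<Rightarrow> nat \<Rightarrow> nat" where
  "left_act i w = (if inv w i < inv w (Suc i) then sg i \<circ> w else w)"

lemma right_act_Sym: "w \<in> Sym n \<Longrightarrow> i \<in> {1..<n} \<Longrightarrow> right_act i w \<in> Sym n"
  using Sym_comp sg_in_Sym by (simp add: right_act_def)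

lemma inv_inv: "w \<in> Sym n \<Longrightarrow> inv (inv w) = w"
  by (simp add: Sym_bij inv_inv_eq)

lemma inv_right_act: "w \<in> Sym n \<Longrightarrow> inv (right_act i w) = left_act i (inv w)"
  by (simp add: right_act_def left_act_def inv_inv inv_comp_sg)

text \<open>This is the source of associativity. The two actions can interfere only if
  \<open>w\<close> maps \<open>{i, Suc i}\<close> onto \<open>{j, Suc j}\<close>. If it does so
  increasingly, both multiplications give the same permutation and the second action is idle; if
  decreasingly, both are idle from the start. Otherwise neither action changes the ascent test of
  the other.\<close>

lemma left_right_act_commute:
  assumes w: "w \<in> Sym n"
  shows "left_act j (right_act i w) = right_act i (left_act j w)"
proof -
  have bw: "bij w" using w by (rule Sym_bij)
  have wi [simp]: "inv w (w k) = k" "w (inv w k) = k" for k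
    using bw by (simp_all add: bij_is_inj bij_is_surj surj_f_inv_f)
  have inv': "inv (w \<circ> sg i) = sg i \<circ> inv w" using w by (rule inv_comp_sg)
  consider (asc) "w i = j" "w (Suc i) = Suc j" | (desc) "w i = Suc j" "w (Suc i) = j"
    | (other) "{w i, w (Suc i)} \<noteq> {j, Suc j}"
    unfolding doubleton_eq_iff by argo
  then show ?thesis
  proof cases
    case asc
    then have invs: "inv w j = i" "inv w (Suc j) = Suc i" using wi by metis+
    have "w \<circ> sg i = sg j \<circ> w"
    proof
      fix k show "(w \<circ> sg i) k = (sg j \<circ> w) k"
        using asc by (cases "k = i \<or> k = Suc i") (auto, metis invs sg_simps(3) wi(1))
    qed
    then show ?thesis using asc invs inv' by (simp add: left_act_def right_act_def)
  next
    case desc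
    then have invs: "inv w j = Suc i" "inv w (Suc j) = i" using wi by metis+
    then show ?thesis using desc by (simp add: left_act_def right_act_def)
  next
    case other
    have "sg i (inv w j) < sg i (inv w (Suc j)) \<longleftrightarrow> inv w j < inv w (Suc j)"
      by (rule sg_less_iff) (use other in \<open>metis wi(2) insert_commute\<close>)+
    moreover have "sg j (w i) < sg j (w (Suc i)) \<longleftrightarrow> w i < w (Suc i)"
      by (rule sg_less_iff) (use other in \<open>metis insert_commute\<close>)+
    ultimately show ?thesis
      using inv' by (simp add: left_act_def right_act_def comp_assoc)
  qed
qed

section \<open>Values of arbitrary, possibly non-reduced, words in the 0-Hecke monoid\<close>

definition hecke :: "nat list \<Rightarrow> nat \<Rightarrow> nat" where
  "hecke xs = fold right_act xs id"

lemma hecke_Nil [simp]: "hecke [] = id"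
  by (simp add: hecke_def)

lemma hecke_snoc: "hecke (xs @ [i]) = right_act i (hecke xs)"
  by (simp add: hecke_def)

lemma hecke_single: "hecke [i] = sg i"
  by (simp add: hecke_def right_act_def)

lemma hecke_Sym: "set xs \<subseteq> {1..<n} \<Longrightarrow> hecke xs \<in> Sym n"
  by (induction xs rule: rev_induct) (auto simp: hecke_snoc intro!: right_act_Sym)

text \<open>Since left and right actions commute, a word may be evaluated from either end.\<close>

lemma hecke_Cons: "i \<in> {1..<n} \<Longrightarrow> set xs \<subseteq> {1..<n} \<Longrightarrow> hecke (i # xs) = left_act i (hecke xs)"
proof (induction xs rule: rev_induct)
  case Nil
  then show ?case by (simp add: hecke_single left_act_def)
next
  case (snoc j xs)
  have "hecke (i # xs @ [j]) = right_act j (hecke (i # xs))"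
    using hecke_snoc[of "i # xs"] by simp
  then show ?case using snoc left_right_act_commute[OF hecke_Sym[of xs n]]
    by (simp add: hecke_snoc)
qed

lemma inv_hecke: "set xs \<subseteq> {1..<n} \<Longrightarrow> inv (hecke xs) = hecke (rev xs)"
proof (induction xs rule: rev_induct)
  case (snoc i xs)
  then show ?case using hecke_Cons[of i n "rev xs"] hecke_Sym[of xs n]
    by (simp add: hecke_snoc inv_right_act)
qed simp

text \<open>This makes concatenation well defined on values of words. The left factor enters as the
  starting value of the right actions; for the right factor, the letters of \<open>xs'\<close> are
  read as left actions on its value.\<close>

lemma hecke_append_cong:
  assumes "set xs \<subseteq> {1..<n}" "set xs' \<subseteq> {1..<n}" "set ys \<subseteq> {1..<n}" "set ys' \<subseteq> {1..<n}"
    and "hecke xs = hecke xs'" "hecke ys = hecke ys'"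
  shows "hecke (xs @ ys) = hecke (xs' @ ys')"
proof -
  have "hecke (xs @ ys) = hecke (xs' @ ys)"
    using assms(5) by (simp add: hecke_def)
  also have "\<dots> = hecke (xs' @ ys')"
    using assms(2)
  proof (induction xs')
    case (Cons i xs')
    then show ?case using assms hecke_Cons[of i n "xs' @ ys"] hecke_Cons[of i n "xs' @ ys'"] by auto
  qed (use assms in simp)
  finally show ?thesis .
qed

lemma heckeE:
  assumes "w \<in> Sym n"
  obtains xs where "set xs \<subseteq> {1..<n}" "hecke xs = w"
proof -
  have "\<exists>xs. set xs \<subseteq> {1..<n} \<and> hecke xs = w"
    using assms
  proof (induction rule: Sym_induct)
    case id
    show ?case by (intro exI[of _ "[]"]) simp
  next
    case (step w i)
    then obtain xs where "set xs \<subseteq> {1..<n}" "hecke xs = w" by blast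
    then show ?case using step by (intro exI[of _ "xs @ [i]"]) (auto simp: hecke_snoc right_act_def)
  qed
  then show ?thesis using that by blast
qed

definition hecke_word :: "nat \<Rightarrow> (nat \<Rightarrow> nat) \<Rightarrow> nat list" where
  "hecke_word n w = (SOME xs. set xs \<subseteq> {1..<n} \<and> hecke xs = w)"

lemma hecke_word:
  assumes "w \<in> Sym n"
  shows "set (hecke_word n w) \<subseteq> {1..<n}" "hecke (hecke_word n w) = w"
proof -
  have "\<exists>xs. set xs \<subseteq> {1..<n} \<and> hecke xs = w" using heckeE[OF assms] by blast
  from someI_ex[OF this] show "set (hecke_word n w) \<subseteq> {1..<n}" "hecke (hecke_word n w) = w"
    by (auto simp: hecke_word_def)
qed

section \<open>Existence and uniqueness of the Demazure product\<close>

text \<open>Associativity reduces a product to products with single generators, whose values are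
  prescribed; the empty word is handled by the unit law. As every element of \<open>Sym n\<close> is
  the value of a word, this gives uniqueness.\<close>

lemma demazure_product_hecke:
  assumes m: "is_demazure_product n m" and "set xs \<subseteq> {1..<n}" "set ys \<subseteq> {1..<n}"
  shows "m (hecke xs, hecke ys) = hecke (xs @ ys)"
  using assms(3)
proof (induction ys rule: rev_induct)
  case Nil
  show "m (hecke xs, hecke []) = hecke (xs @ [])"
    using m hecke_Sym[OF assms(2)] by (simp add: is_demazure_product_def)
next
  case (snoc i ys)
  have sgi: "sg i \<in> simple_gens n" using snoc by (auto simp: simple_gens_def)
  have right: "m (w, sg i) = right_act i w" if "w \<in> Sym n" for w
    using m that sgi len_comp_sg_gt_iff[of w n i] snoc.prems
    by (auto simp: is_demazure_product_def right_act_def)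
  have "m (hecke xs, hecke (ys @ [i])) = m (hecke xs, m (hecke ys, sg i))"
    using right hecke_Sym snoc.prems by (simp add: hecke_snoc)
  also have "\<dots> = m (m (hecke xs, hecke ys), sg i)"
    using m hecke_Sym[of xs n] hecke_Sym[of ys n] sg_in_Sym[of i n] assms(2) snoc.prems
    by (auto simp: is_demazure_product_def)
  also have "\<dots> = hecke (xs @ ys @ [i])"
    using snoc right hecke_Sym[of "xs @ ys" n] assms(2) hecke_snoc[of "xs @ ys" i] by simp
  finally show ?case .
qed

text \<open>Concatenating chosen words defines the product. By \<open>hecke_append_cong\<close> the
  choice is immaterial, so associativity and the unit law are inherited from lists.\<close>

lemma demazure_product_exists:
  "\<exists>m \<in> (Sym n \<times> Sym n) \<rightarrow>\<^sub>E Sym n. is_demazure_product n m"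
proof -
  define m where "m = restrict (\<lambda>(u, v). hecke (hecke_word n u @ hecke_word n v)) (Sym n \<times> Sym n)"
  have m: "m (hecke xs, hecke ys) = hecke (xs @ ys)"
    if "set xs \<subseteq> {1..<n}" "set ys \<subseteq> {1..<n}" for xs ys
    using that hecke_Sym hecke_word[OF hecke_Sym[of xs n]] hecke_word[OF hecke_Sym[of ys n]]
    by (auto simp: m_def intro!: hecke_append_cong)
  have "m (m (u, v), w) = m (u, m (v, w))" if uvw: "u \<in> Sym n" "v \<in> Sym n" "w \<in> Sym n" for u v w
  proof -
    obtain xs where "set xs \<subseteq> {1..<n}" "hecke xs = u" using uvw(1) by (rule heckeE)
    moreover obtain ys where "set ys \<subseteq> {1..<n}" "hecke ys = v" using uvw(2) by (rule heckeE)
    moreover obtain zs where "set zs \<subseteq> {1..<n}" "hecke zs = w" using uvw(3) by (rule heckeE)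
    ultimately show ?thesis using m[of xs ys] m[of ys zs] m[of "xs @ ys" zs] m[of xs "ys @ zs"] by simp
  qed
  moreover have "m (id, w) = w \<and> m (w, id) = w" if w: "w \<in> Sym n" for w
  proof -
    obtain xs where xs: "set xs \<subseteq> {1..<n}" "hecke xs = w" using w by (rule heckeE)
    then show ?thesis using m[of "[]" xs] m[of xs "[]"] by auto
  qed
  moreover have "m (sg i, w) = (if len n (sg i \<circ> w) > len n w then sg i \<circ> w else w) \<and>
        m (w, sg i) = (if len n (w \<circ> sg i) > len n w then w \<circ> sg i else w)"
    if i: "i \<in> {1..<n}" and w: "w \<in> Sym n" for i w
  proof -
    obtain xs where xs: "set xs \<subseteq> {1..<n}" "hecke xs = w" using w by (rule heckeE)
    then show ?thesis
      using i w m[of "[i]" xs] m[of xs "[i]"] len_comp_sg_gt_iff[OF w i] len_sg_comp_gt_iff[OF w i]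
      by (simp add: hecke_single hecke_snoc hecke_Cons[of i n xs] left_act_def right_act_def)
  qed
  ultimately have "is_demazure_product n m"
    by (auto simp: is_demazure_product_def simple_gens_def)
  moreover have "m \<in> (Sym n \<times> Sym n) \<rightarrow>\<^sub>E Sym n"
  proof -
    have "hecke (hecke_word n u @ hecke_word n v) \<in> Sym n" if "u \<in> Sym n" "v \<in> Sym n" for u v
      using that hecke_word by (intro hecke_Sym) simp
    then show ?thesis by (auto simp: m_def)
  qed
  ultimately show ?thesis by blast
qed

lemma demazure_hecke:
  assumes xs: "set xs \<subseteq> {1..<n}" and ys: "set ys \<subseteq> {1..<n}"
  shows "demazure n (hecke xs) (hecke ys) = hecke (xs @ ys)"
proof -
  let ?P = "\<lambda>m. m \<in> (Sym n \<times> Sym n) \<rightarrow>\<^sub>E Sym n \<and> is_demazure_product n m"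
  have "\<exists>!m. ?P m"
  proof (rule ex_ex1I)
    show "\<exists>m. ?P m" using demazure_product_exists by blast
  next
    fix m m' assume m: "?P m" "?P m'"
    have "m (u, v) = m' (u, v)" if uv: "u \<in> Sym n" "v \<in> Sym n" for u v
    proof -
      obtain us where us: "set us \<subseteq> {1..<n}" "hecke us = u" using uv(1) by (rule heckeE)
      obtain vs where vs: "set vs \<subseteq> {1..<n}" "hecke vs = v" using uv(2) by (rule heckeE)
      show ?thesis
        using m demazure_product_hecke[OF _ us(1) vs(1)] unfolding us(2) vs(2) by simp
    qed
    then have "m p = m' p" if "p \<in> Sym n \<times> Sym n" for p
      using that by (cases p) simp
    \<comment> \<open>Outside \<open>Sym n \<times> Sym n\<close> both functions take the default
      value of the extensional function space.\<close>
    then show "m = m'" using m by (meson PiE_ext)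
  qed
  from theI'[OF this] show ?thesis
    unfolding demazure_def using demazure_product_hecke xs ys by blast
qed

section \<open>Demazure conjugation of involutions\<close>

definition demazure_conj :: "nat \<Rightarrow> (nat \<Rightarrow> nat) \<Rightarrow> (nat \<Rightarrow> nat) \<Rightarrow> nat \<Rightarrow> nat" where
  "demazure_conj n x w = demazure n (demazure n (inv w) x) w"

lemma demazure_conj_hecke:
  assumes "set xs \<subseteq> {1..<n}" "set ws \<subseteq> {1..<n}"
  shows "demazure_conj n (hecke xs) (hecke ws) = hecke (rev ws @ xs @ ws)"
  using assms by (simp add: demazure_conj_def inv_hecke demazure_hecke)

lemma demazure_conj_id [simp]:
  assumes x: "x \<in> Sym n"
  shows "demazure_conj n x id = x"
proof -
  obtain xs where "set xs \<subseteq> {1..<n}" "hecke xs = x" using x by (rule heckeE)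
  then show ?thesis using demazure_conj_hecke[of xs n "[]"] by simp
qed

text \<open>Inversion reverses words. Reversing \<open>rev ws @ xs @ ws\<close> changes only its
  middle part, to \<open>rev xs\<close>, which has the same value because \<open>x\<close> is its
  own inverse.\<close>

lemma demazure_conj_Invol:
  assumes x: "x \<in> Invol n" and w: "w \<in> Sym n"
  shows "demazure_conj n x w \<in> Invol n"
proof -
  have xS: "x \<in> Sym n" "inv x = x" using x by (auto simp: Invol_def inv_unique_comp)
  obtain xs where xs: "set xs \<subseteq> {1..<n}" "hecke xs = x" using xS(1) by (rule heckeE)
  obtain ws where ws: "set ws \<subseteq> {1..<n}" "hecke ws = w" using w by (rule heckeE)
  let ?z = "hecke (rev ws @ xs @ ws)"
  have z: "?z \<in> Sym n" using xs ws by (intro hecke_Sym) auto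
  have "inv ?z = hecke (rev ws @ rev xs @ ws)"
    using xs ws inv_hecke[of "rev ws @ xs @ ws" n] by simp
  also have "\<dots> = ?z"
    using xs ws xS inv_hecke[of xs n] by (intro hecke_append_cong[where n = n]) auto
  finally have "inv ?z = ?z" .
  then have "?z \<circ> ?z = id" using Sym_bij[OF z] by (metis bij_is_surj surj_iff)
  then show ?thesis using z demazure_conj_hecke[OF xs(1) ws(1)] xs ws by (simp add: Invol_def)
qed

text \<open>Closed form of the two-sided Demazure product of \<open>z\<close> with
  \<open>sg i\<close>. In the middle case \<open>sg i\<close> commutes with \<open>z\<close>, so a
  factor on one side already produces a descent on the other.\<close>

definition invol_act :: "nat \<Rightarrow> (nat \<Rightarrow> nat) \<Rightarrow> nat \<Rightarrow> nat" where
  "invol_act i z = (if z (Suc i) < z i then z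
     else if z i = i \<and> z (Suc i) = Suc i then z \<circ> sg i else sg i \<circ> z \<circ> sg i)"

lemma left_right_act_invol:
  assumes z: "z \<in> Invol n"
  shows "left_act i (right_act i z) = invol_act i z"
proof -
  have zS: "z \<in> Sym n" "inv z = z" using z by (auto simp: Invol_def inv_unique_comp)
  have zz: "z (z k) = k" for k using z by (auto simp: Invol_def fun_eq_iff)
  show ?thesis
  proof (cases "z i < z (Suc i)")
    case True
    have "sg i (z i) < sg i (z (Suc i)) \<longleftrightarrow> \<not> (z i = i \<and> z (Suc i) = Suc i)"
      using True sg_less_iff[of "z i" i "z (Suc i)"] by auto
    then show ?thesis using True inv_comp_sg[OF zS(1)] zS
      by (auto simp: left_act_def right_act_def invol_act_def comp_assoc)
  next
    case False
    then show ?thesis using Sym_neq_Suc[OF zS(1), of i] zS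
      by (auto simp: left_act_def right_act_def invol_act_def)
  qed
qed

text \<open>Appending the letter \<open>i\<close> to a word of \<open>w\<close> puts an
  \<open>i\<close> at both ends of the palindromic word \<open>rev ws @ xs @ ws\<close>.\<close>

lemma demazure_conj_right_act:
  assumes x: "x \<in> Invol n" and w: "w \<in> Sym n" and i: "i \<in> {1..<n}"
  shows "demazure_conj n x (right_act i w) = invol_act i (demazure_conj n x w)"
proof -
  have "x \<in> Sym n" using x by (simp add: Invol_def)
  then obtain xs where xs: "set xs \<subseteq> {1..<n}" "hecke xs = x" by (rule heckeE)
  obtain ws where ws: "set ws \<subseteq> {1..<n}" "hecke ws = w" using w by (rule heckeE)
  let ?z = "demazure_conj n x w"
  have z: "?z = hecke (rev ws @ xs @ ws)" using demazure_conj_hecke[OF xs(1) ws(1)] xs(2) ws(2) by simp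
  have "demazure_conj n x (right_act i w) = hecke (rev (ws @ [i]) @ xs @ ws @ [i])"
    using demazure_conj_hecke[of xs n "ws @ [i]"] xs ws i by (simp add: hecke_snoc)
  also have "\<dots> = left_act i (hecke ((rev ws @ xs @ ws) @ [i]))"
    using hecke_Cons[of i n "rev ws @ xs @ ws @ [i]"] xs ws i by simp
  also have "\<dots> = left_act i (right_act i ?z)"
    unfolding hecke_snoc z ..
  finally show ?thesis using left_right_act_invol[OF demazure_conj_Invol[OF x w]] by simp
qed
subsection \<open>The pattern conditions\<close>

text \<open>The order conditions of the theorem with the positions \<open>a b a' b'\<close> and the
  values \<open>p q p' q'\<close> kept as separate arguments, so that positions can be relabelled
  while values stay put.\<close>

definition order_cond ::
  "nat \<Rightarrow> nat \<Rightarrow> nat \<Rightarrow> nat \<Rightarrow> nat \<Rightarrow> nat \<Rightarrow> nat \<Rightarrow> nat \<Rightarrow> bool" where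
  "order_cond a b a' b' p q p' q' \<longleftrightarrow>
     (a \<le> b \<and> b < a' \<and> a' \<le> b' \<longrightarrow> p < p' \<and> p < q' \<and> q < q' \<and> q < p') \<and>
     (a < a' \<and> a' < b \<and> b < b' \<longrightarrow> p < p' \<and> p < q' \<and> q < q') \<and>
     (a < a' \<and> a' < b' \<and> b' < b \<longrightarrow>
        \<not> (q < p' \<and> p' < p) \<and> \<not> (q < q' \<and> q' < p) \<and>
        \<not> (p' < p \<and> p < q \<and> q < q') \<and> \<not> (p' < q \<and> q \<le> p \<and> p < q')) \<and>
     (a < a' \<and> a' = b' \<and> b' < b \<longrightarrow> \<not> (q < p' \<and> p' = q' \<and> q' < p))"

text \<open>Both orders of a pair of cycles, with positions relabelled by \<open>f\<close>. Taking
  \<open>f = sg i\<close> describes the conjugated cycles, on which \<open>w \<circ> sg i\<close>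
  has the values of \<open>w\<close> on the old ones.\<close>

definition opair where
  "opair f w a b c d \<longleftrightarrow> order_cond (f a) (f b) (f c) (f d) (w a) (w b) (w c) (w d) \<and>
     order_cond (f c) (f d) (f a) (f b) (w c) (w d) (w a) (w b)"

lemma opair_sym: "opair f w a b c d \<longleftrightarrow> opair f w c d a b"
  by (auto simp: opair_def)

lemma order_cond_cong:
  assumes "\<And>u v. u \<in> {a,b,c,d} \<Longrightarrow> v \<in> {a,b,c,d} \<Longrightarrow> f u < f v \<longleftrightarrow> u < v"
  shows "order_cond (f a) (f b) (f c) (f d) p q r t = order_cond a b c d p q r t"
proof -
  have "f u \<le> f v \<longleftrightarrow> u \<le> v" if "u \<in> {a,b,c,d}" "v \<in> {a,b,c,d}" for u v
    using assms[OF that(2,1)] by linarith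
  moreover have "f u = f v \<longleftrightarrow> u = v" if "u \<in> {a,b,c,d}" "v \<in> {a,b,c,d}" for u v
    using assms[OF that] assms[OF that(2,1)] by (metis less_irrefl linorder_neqE_nat)
  ultimately show ?thesis
    using assms unfolding order_cond_def by simp
qed

text \<open>Relabelling matters only if \<open>i\<close> lies on one cycle and \<open>Suc i\<close>
  on the other. It then turns nested cycles into crossing ones, crossing into disjoint ones, or
  moves a fixed point out of a cycle. In each case \<open>w (Suc i) < w i\<close> makes the old and
  the new condition agree.\<close>

lemma opair_sg:
  assumes inv: "\<And>k. y (y k) = k" and w: "inj w"
    and desc: "y (Suc i) < y i" "y i \<noteq> Suc i" "w (Suc i) < w i"
    and cyc: "a \<le> y a" "c \<le> y c"
  shows "opair (sg i) w a (y a) c (y c) \<longleftrightarrow> opair id w a (y a) c (y c)"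
proof -
  have main: "opair (sg i) w a (y a) c (y c) \<longleftrightarrow> opair id w a (y a) c (y c)"
    if ac: "a \<le> y a" "c \<le> y c" "i \<in> {a, y a}" "Suc i \<in> {c, y c}" for a c
  proof -
    have winj: "w u = w v \<longleftrightarrow> u = v" for u v using w by (auto dest: injD)
    have si: "sg i i = Suc i" "sg i (Suc i) = i" "\<And>u. u \<noteq> i \<Longrightarrow> u \<noteq> Suc i \<Longrightarrow> sg i u = u"
      by (auto simp: simple_gen_def)
    have ysi: "y (Suc i) \<noteq> i" using inv[of "Suc i"] desc by auto
    \<comment> \<open>The missing combination, \<open>y a = i\<close> with \<open>a < i\<close> and
      \<open>c = Suc i\<close>, would give \<open>y i < Suc i \<le> y (Suc i)\<close>, against the
      descent of \<open>y\<close>.\<close>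
    consider "a = i" "c = Suc i" | "a = i" "y c = Suc i" "c < i" | "y a = i" "y c = Suc i" "a < i" "c < a"
      using ac desc ysi inv by (smt (verit) empty_iff insertE le_less_Suc_eq le_neq_implies_less less_Suc_eq nat_less_le not_less_eq order.strict_trans)
    then show ?thesis
    proof cases
      case 1
      have yc: "Suc i \<le> y c" "y c < y a" using 1 ac desc by auto
      have ne: "w (y a) \<noteq> w i" "w (y a) \<noteq> w (Suc i)" "w (y a) \<noteq> w (y c)" "w (y c) \<noteq> w i"
        using 1 yc by (auto simp: winj)
      show ?thesis
      proof (cases "y c = Suc i")
        case True
        then show ?thesis using 1 yc ne desc unfolding opair_def order_cond_def by (auto simp: si nat_neq_iff)
      next
        case False
        then have "w (y c) \<noteq> w (Suc i)" by (simp add: winj)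
        then show ?thesis using False 1 yc ne desc(3) unfolding opair_def order_cond_def by (auto simp: si nat_neq_iff)
      qed
    next
      case 2
      have ya: "i \<le> y a" "y a \<noteq> Suc i" "c < y a" using 2 desc ac inv[of c] by auto
      have ne: "w c \<noteq> w i" "w c \<noteq> w (Suc i)" "w (y a) \<noteq> w (Suc i)" "w (y a) \<noteq> w c"
        using 2 ya by (auto simp: winj)
      show ?thesis
      proof (cases "y a = i")
        case True
        then show ?thesis using 2 ya ne desc(3) unfolding opair_def order_cond_def by (auto simp: si nat_neq_iff)
      next
        case False
        then have "w (y a) \<noteq> w i" by (simp add: winj)
        then show ?thesis using False 2 ya ne desc(3) unfolding opair_def order_cond_def by (auto simp: si nat_neq_iff)
      qed
    next
      case 3
      have ne: "w a \<noteq> w i" "w a \<noteq> w (Suc i)" "w c \<noteq> w (Suc i)" "w c \<noteq> w i" "w a \<noteq> w c"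
        using 3 by (auto simp: winj)
      then show ?thesis using 3 desc(3) unfolding opair_def order_cond_def by (auto simp: si nat_neq_iff)
    qed
  qed
  show ?thesis
  proof (cases "i \<in> {a, y a, c, y c} \<and> Suc i \<in> {a, y a, c, y c}")
    case False
    have less: "sg i u < sg i v \<longleftrightarrow> u < v"
      if "u \<in> {a,y a,c,y c}" "v \<in> {a,y a,c,y c}" for u v
      using False that by (intro sg_less_iff) metis+
    have "order_cond (sg i a) (sg i (y a)) (sg i c) (sg i (y c)) p q r t =
        order_cond a (y a) c (y c) p q r t"
      "order_cond (sg i c) (sg i (y c)) (sg i a) (sg i (y a)) p q r t =
        order_cond c (y c) a (y a) p q r t" for p q r t
      by (rule order_cond_cong; use less in blast)+
    then show ?thesis unfolding opair_def by simp
  next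
    case True
    have "\<not> (i \<in> {a, y a} \<and> Suc i \<in> {a, y a})" "\<not> (i \<in> {c, y c} \<and> Suc i \<in> {c, y c})"
      using desc(2) inv by (metis insertE n_not_Suc_n singletonD)+
    with True have "i \<in> {a, y a} \<and> Suc i \<in> {c, y c} \<or> i \<in> {c, y c} \<and> Suc i \<in> {a, y a}" by blast
    then show ?thesis using main cyc opair_sym by meson
  qed
qed

section \<open>The conditions on all cycles at once, and how one move changes them\<close>

definition cyc_mins :: "nat \<Rightarrow> (nat \<Rightarrow> nat) \<Rightarrow> nat set" where
  "cyc_mins n y = {a \<in> {1..n}. a \<le> y a}"

definition value_cond :: "(nat \<Rightarrow> nat) \<Rightarrow> nat \<Rightarrow> nat \<Rightarrow> bool" where
  "value_cond x p q \<longleftrightarrow> (if p < q then x p = q else x p = p \<and> x q = q)"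

definition atom_pattern :: "nat \<Rightarrow> (nat \<Rightarrow> nat) \<Rightarrow> (nat \<Rightarrow> nat) \<Rightarrow> (nat \<Rightarrow> nat) \<Rightarrow> bool" where
  "atom_pattern n x y w \<longleftrightarrow>
     (\<forall>a\<in>cyc_mins n y. value_cond x (w a) (w (y a))) \<and>
     (\<forall>a\<in>cyc_mins n y. \<forall>c\<in>cyc_mins n y. opair id w a (y a) c (y c))"

lemma InvolD:
  assumes "y \<in> Invol n"
  shows "y \<in> Sym n" "y (y k) = k" "k \<in> {1..n} \<Longrightarrow> y k \<in> {1..n}"
  using assms permutes_in_image[of y "{1..n}"] by (auto simp: Invol_def Sym_def fun_eq_iff)

text \<open>The range constraints in \<open>Cyc\<close> and \<open>Fix\<close> are automatic because
  \<open>w\<close> and \<open>y\<close> preserve \<open>{1..n}\<close>; quantifying over all ordered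
  pairs of cycles accounts for both halves of \<open>opair\<close>.\<close>

lemma atom_pattern_iff:
  assumes x: "x \<in> Invol n" and y: "y \<in> Invol n" and w: "w \<in> Sym n"
  shows "atom_pattern n x y w \<longleftrightarrow>
    (\<forall>a b a' b'. (a, b) \<in> Cyc n y \<and> (a', b') \<in> Cyc n y \<longrightarrow>
       (if w a < w b then (w a, w b) \<in> Cyc n x else {w a, w b} \<subseteq> Fix n x) \<and>
       order_cond a b a' b' (w a) (w b) (w a') (w b'))"
proof -
  have Cyc_y: "(a, b) \<in> Cyc n y \<longleftrightarrow> a \<in> cyc_mins n y \<and> b = y a" for a b
    using InvolD(3)[OF y, of a] by (auto simp: Cyc_def cyc_mins_def)
  have wn: "w a \<in> {1..n}" "w (y a) \<in> {1..n}" if "a \<in> cyc_mins n y" for a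
    using that InvolD(3)[OF y, of a] w permutes_in_image[of w "{1..n}"]
    by (auto simp: Sym_def cyc_mins_def)
  have vals: "(if w a < w (y a) then (w a, w (y a)) \<in> Cyc n x else {w a, w (y a)} \<subseteq> Fix n x) \<longleftrightarrow>
      value_cond x (w a) (w (y a))" if "a \<in> cyc_mins n y" for a
    using wn[OF that] InvolD(2)[OF x] by (auto simp: Cyc_def Fix_def value_cond_def)
  show ?thesis
    unfolding atom_pattern_def opair_def id_apply using vals by (auto simp: Cyc_y)
qed

text \<open>If \<open>y\<close> had an ascent at \<open>i\<close>, the cycles through
  \<open>i\<close> and \<open>Suc i\<close> would be disjoint or crossing in this order, and either
  condition forces \<open>w i < w (Suc i)\<close>.\<close>

lemma atom_pattern_descent:
  assumes y: "y \<in> Invol n" and i: "i \<in> {1..<n}" and desc: "w (Suc i) < w i"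
    and P: "atom_pattern n x y w"
  shows "y (Suc i) < y i"
proof (rule ccontr)
  assume "\<not> y (Suc i) < y i"
  then have less: "y i < y (Suc i)"
    using Sym_neq_Suc[OF InvolD(1)[OF y], of i] by simp
  note yy = InvolD(2)[OF y]
  have ord: "order_cond a (y a) c (y c) (w a) (w (y a)) (w c) (w (y c))"
    if "a \<in> {i, y i}" "a \<le> y a" "c \<in> {Suc i, y (Suc i)}" "c \<le> y c" for a c
  proof -
    have "a \<in> cyc_mins n y" "c \<in> cyc_mins n y"
      using that i InvolD(3)[OF y, of i] InvolD(3)[OF y, of "Suc i"] by (auto simp: cyc_mins_def)
    with P show ?thesis by (simp add: atom_pattern_def opair_def)
  qed
  have ne: "y i \<noteq> Suc i" "y (Suc i) \<noteq> i" using less yy[of i] yy[of "Suc i"] by auto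
  show False
  proof (cases "i \<le> y i"; cases "Suc i \<le> y (Suc i)")
    assume "i \<le> y i" "Suc i \<le> y (Suc i)"
    with ord[of i "Suc i"] less ne desc show False
      by (cases "y i = i") (auto simp: order_cond_def)
  next
    assume "\<not> i \<le> y i" "Suc i \<le> y (Suc i)"
    with ord[of "y i" "Suc i"] less ne desc show False
      by (auto simp: order_cond_def yy)
  next
    assume "\<not> i \<le> y i" "\<not> Suc i \<le> y (Suc i)"
    with ord[of "y i" "y (Suc i)"] less ne desc show False
      by (auto simp: order_cond_def yy)
  qed (use less in auto)
qed

lemma sg_in_atLeastAtMost_iff: "i \<in> {1..<n} \<Longrightarrow> sg i a \<in> {1..n} \<longleftrightarrow> a \<in> {1..n}"
  by (auto simp: simple_gen_def transpose_def)

text \<open>No cycle of \<open>y\<close> is \<open>(i, Suc i)\<close>, so \<open>sg i\<close> maps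
  the cycles of \<open>y\<close> to those of the conjugate, minima to minima, and the values on them
  are unchanged. What remains is \<open>opair_sg\<close>.\<close>

lemma atom_pattern_conj:
  assumes y: "y \<in> Invol n" and i: "i \<in> {1..<n}" and w: "w \<in> Sym n"
    and desc: "y (Suc i) < y i" "w (Suc i) < w i" and ne: "y i \<noteq> Suc i"
  shows "atom_pattern n x (sg i \<circ> y \<circ> sg i) (w \<circ> sg i) \<longleftrightarrow> atom_pattern n x y w"
proof -
  let ?z = "sg i \<circ> y \<circ> sg i" and ?v = "w \<circ> sg i"
  note yy = InvolD(2)[OF y]
  have "sg i (y a) < sg i a \<longleftrightarrow> y a < a" for a
    by (rule sg_less_iff) (use ne yy[of i] yy[of "Suc i"] in auto)
  then have le: "sg i a \<le> sg i (y a) \<longleftrightarrow> a \<le> y a" for a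
    by (simp add: not_less[symmetric])
  have "sg i a \<in> cyc_mins n ?z \<longleftrightarrow> a \<in> cyc_mins n y" for a
    unfolding cyc_mins_def using sg_in_atLeastAtMost_iff[OF i] le by auto
  then have "cyc_mins n ?z = sg i ` cyc_mins n y"
    by (metis (no_types, lifting) image_eqI sg_simps(4) subsetI subset_antisym image_subset_iff)
  moreover have "opair id ?v (sg i a) (?z (sg i a)) (sg i c) (?z (sg i c)) \<longleftrightarrow>
      opair id w a (y a) c (y c)" if "a \<in> cyc_mins n y" "c \<in> cyc_mins n y" for a c
  proof -
    have "opair id ?v (sg i a) (?z (sg i a)) (sg i c) (?z (sg i c)) \<longleftrightarrow>
        opair (sg i) w a (y a) c (y c)"
      by (simp add: opair_def)
    also have "\<dots> \<longleftrightarrow> opair id w a (y a) c (y c)"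
      using that Sym_bij[OF w] yy desc ne by (intro opair_sg) (auto simp: cyc_mins_def bij_is_inj)
    finally show ?thesis .
  qed
  ultimately show ?thesis
    by (simp add: atom_pattern_def)
qed

text \<open>A cycle disjoint from \<open>(i, Suc i)\<close> lies to its left, to its right, or
  encloses it. In the enclosing case \<open>t < r\<close> rules out the last two forbidden patterns
  of nesting, and the first two are the conditions for fixed points with values \<open>r\<close> and
  \<open>t\<close>.\<close>

lemma order_cond_split:
  assumes "t < r" and "a \<le> b \<and> b < i \<or> a \<le> b \<and> Suc i < a \<or> a < i \<and> Suc i < b"
  shows "order_cond a b i (Suc i) p q r t \<and> order_cond i (Suc i) a b r t p q \<longleftrightarrow>
    (order_cond a b i i p q t t \<and> order_cond i i a b t t p q) \<and>
    (order_cond a b (Suc i) (Suc i) p q r r \<and> order_cond (Suc i) (Suc i) a b r r p q)"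
  using assms(2)
  by (elim disjE conjE; insert assms(1);
      unfold order_cond_def; simp add: not_less; linarith?)

text \<open>A 2-cycle \<open>(i, i + 1)\<close> whose values under \<open>w\<close> descend behaves towards all other cycles
  like two fixed points with the values exchanged.\<close>
lemma opair_split:
  assumes "a \<le> b" "a \<notin> {i, Suc i}" "b \<notin> {i, Suc i}" and desc: "w (Suc i) < w i"
  shows "opair id w a b i (Suc i) \<longleftrightarrow>
    opair id (w \<circ> sg i) a b i i \<and> opair id (w \<circ> sg i) a b (Suc i) (Suc i)"
proof -
  have "a \<le> b \<and> b < i \<or> a \<le> b \<and> Suc i < a \<or> a < i \<and> Suc i < b"
    using assms(1-3) by (cases "b < i"; cases "Suc i < a") auto
  moreover have "(w \<circ> sg i) a = w a" "(w \<circ> sg i) b = w b"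
    "(w \<circ> sg i) i = w (Suc i)" "(w \<circ> sg i) (Suc i) = w i"
    using assms by auto
  ultimately show ?thesis
    unfolding opair_def id_apply by (simp only: order_cond_split[OF desc])
qed

text \<open>The cycle \<open>(i, Suc i)\<close> of \<open>y\<close> breaks into two fixed points. As
  \<open>w\<close> descends on it, the value condition asks for two fixed points of \<open>x\<close>
  before and after; the order conditions against other cycles are matched by
  \<open>opair_split\<close>.\<close>

lemma atom_pattern_swap:
  assumes y: "y \<in> Invol n" and i: "i \<in> {1..<n}" and w: "w \<in> Sym n"
    and desc: "w (Suc i) < w i" and yi: "y i = Suc i"
  shows "atom_pattern n x (y \<circ> sg i) (w \<circ> sg i) \<longleftrightarrow> atom_pattern n x y w"
proof -
  let ?z = "y \<circ> sg i" and ?v = "w \<circ> sg i"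
  note yy = InvolD(2)[OF y]
  have ysi: "y (Suc i) = i" using yi yy by metis
  define A where "A = cyc_mins n y - {i, Suc i}"
  have A: "a \<le> y a" "a \<notin> {i, Suc i}" "y a \<notin> {i, Suc i}" if "a \<in> A" for a
    using that yi ysi yy[of a] by (auto simp: A_def cyc_mins_def)
  have mins: "cyc_mins n y = insert i A" "cyc_mins n ?z = insert i (insert (Suc i) A)"
    using i yi ysi by (auto simp: A_def cyc_mins_def)
  have zv: "?z a = y a" "?v a = w a" "?v (y a) = w (y a)" if "a \<in> A" for a
    using A[OF that] by auto
  have vals: "value_cond x (?v a) (?v (?z a)) \<longleftrightarrow> value_cond x (w a) (w (y a))" if "a \<in> A" for a
    using zv[OF that] by simp
  have vals': "value_cond x (?v i) (?v (?z i)) \<and> value_cond x (?v (Suc i)) (?v (?z (Suc i))) \<longleftrightarrow>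
      value_cond x (w i) (w (y i))"
    using desc yi ysi by (auto simp: value_cond_def)
  have AA: "opair id ?v a (?z a) c (?z c) \<longleftrightarrow> opair id w a (y a) c (y c)"
    if "a \<in> A" "c \<in> A" for a c
    using zv[OF that(1)] zv[OF that(2)] by (simp add: opair_def)
  have Ai: "opair id w a (y a) i (y i) \<longleftrightarrow>
      opair id ?v a (?z a) i (?z i) \<and> opair id ?v a (?z a) (Suc i) (?z (Suc i))" if "a \<in> A" for a
    using opair_split[of a "y a" i w] A[OF that] zv(1)[OF that] desc yi ysi by simp
  \<comment> \<open>Pairs formed among the cycles through \<open>i\<close> and \<open>Suc i\<close>
    satisfy the conditions outright; for the two fixed points this holds because
    \<open>w \<circ> sg i\<close> ascends at \<open>i\<close>.\<close>
  have ii: "opair id w i (y i) i (y i)" "opair id ?v i (?z i) i (?z i)"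
    "opair id ?v (Suc i) (?z (Suc i)) (Suc i) (?z (Suc i))" "opair id ?v i (?z i) (Suc i) (?z (Suc i))"
    using desc yi ysi by (auto simp: opair_def order_cond_def)
  have "atom_pattern n x ?z ?v \<longleftrightarrow>
      (value_cond x (?v i) (?v (?z i)) \<and> value_cond x (?v (Suc i)) (?v (?z (Suc i)))) \<and>
      (\<forall>a\<in>A. value_cond x (?v a) (?v (?z a))) \<and>
      (\<forall>a\<in>A. opair id ?v a (?z a) i (?z i) \<and> opair id ?v a (?z a) (Suc i) (?z (Suc i))) \<and>
      (\<forall>a\<in>A. \<forall>c\<in>A. opair id ?v a (?z a) c (?z c))"
    unfolding atom_pattern_def mins
    using ii opair_sym[of id ?v i] opair_sym[of id ?v "Suc i"] by blast
  also have "\<dots> \<longleftrightarrow> value_cond x (w i) (w (y i)) \<and> (\<forall>a\<in>A. value_cond x (w a) (w (y a))) \<and>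
      (\<forall>a\<in>A. opair id w a (y a) i (y i)) \<and> (\<forall>a\<in>A. \<forall>c\<in>A. opair id w a (y a) c (y c))"
    unfolding vals' using vals Ai AA by auto
  also have "\<dots> \<longleftrightarrow> atom_pattern n x y w"
    unfolding atom_pattern_def mins using ii opair_sym[of id w i] by blast
  finally show ?thesis .
qed

subsection \<open>Descending from an involution\<close>

definition invol_down :: "nat \<Rightarrow> (nat \<Rightarrow> nat) \<Rightarrow> nat \<Rightarrow> nat" where
  "invol_down i y = (if y i = Suc i then y \<circ> sg i else sg i \<circ> y \<circ> sg i)"

lemma atom_pattern_down:
  assumes "y \<in> Invol n" "i \<in> {1..<n}" "w \<in> Sym n" "y (Suc i) < y i" "w (Suc i) < w i"
  shows "atom_pattern n x (invol_down i y) (w \<circ> sg i) \<longleftrightarrow> atom_pattern n x y w"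
  using assms atom_pattern_conj[of y n i w x] atom_pattern_swap[of y n i w x]
  by (simp add: invol_down_def)

lemma comp_sg_commute:
  assumes "{y i, y (Suc i)} = {i, Suc i}" "inj y"
  shows "y \<circ> sg i = sg i \<circ> y"
proof
  fix k
  have "y k \<notin> {i, Suc i}" if "k \<notin> {i, Suc i}"
    using that assms by (metis injD insertE singletonD insertI1 insertI2)
  then show "(y \<circ> sg i) k = (sg i \<circ> y) k"
    using assms(1) by (cases "k \<in> {i, Suc i}") (auto simp: doubleton_eq_iff)
qed

lemma Invol_comp_sg:
  assumes y: "y \<in> Invol n" and i: "i \<in> {1..<n}" and "{y i, y (Suc i)} = {i, Suc i}"
  shows "y \<circ> sg i \<in> Invol n"
proof -
  have c: "y \<circ> sg i = sg i \<circ> y"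
    using assms Sym_bij[OF InvolD(1)[OF y]] by (intro comp_sg_commute) (auto simp: bij_is_inj)
  have "(y \<circ> sg i) \<circ> (y \<circ> sg i) = id"
    by (subst (2) c) (simp add: fun_eq_iff InvolD(2)[OF y])
  then show ?thesis
    using Sym_comp[OF InvolD(1)[OF y] sg_in_Sym[OF i]] by (simp add: Invol_def)
qed

lemma Invol_conj_sg:
  assumes y: "y \<in> Invol n" and i: "i \<in> {1..<n}"
  shows "sg i \<circ> y \<circ> sg i \<in> Invol n"
  using Sym_comp[OF Sym_comp[OF sg_in_Sym[OF i] InvolD(1)[OF y]] sg_in_Sym[OF i]]
  by (simp add: Invol_def fun_eq_iff InvolD(2)[OF y])

text \<open>Together with \<open>invol_act_ascent\<close> this makes \<open>invol_down i\<close> and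
  \<open>invol_act i\<close> inverse bijections between involutions with a descent and with an
  ascent at \<open>i\<close>.\<close>

lemma invol_down:
  assumes y: "y \<in> Invol n" and i: "i \<in> {1..<n}" and desc: "y (Suc i) < y i"
  shows "invol_down i y \<in> Invol n" "invol_down i y i < invol_down i y (Suc i)"
    "invol_act i (invol_down i y) = y"
proof -
  note yy = InvolD(2)[OF y]
  have *: "invol_down i y \<in> Invol n \<and> invol_down i y i < invol_down i y (Suc i) \<and>
    invol_act i (invol_down i y) = y"
  proof (cases "y i = Suc i")
    case True
    then have "y (Suc i) = i" using yy by metis
    then show ?thesis using True Invol_comp_sg[OF y i]
      by (auto simp: invol_down_def invol_act_def)
  next
    case False
    have ysi: "y (Suc i) \<noteq> i" using False yy by metis
    have less: "sg i (y (Suc i)) < sg i (y i)"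
      using sg_less_iff[of "y (Suc i)" i "y i"] False ysi desc by auto
    \<comment> \<open>The conjugate does not fix both \<open>i\<close> and \<open>Suc i\<close>, so
      \<open>invol_act\<close> also takes its conjugation branch.\<close>
    have "\<not> (sg i (y (Suc i)) = i \<and> sg i (y i) = Suc i)"
      using False ysi desc by (metis less_asym lessI sg_simps(1,2,4))
    moreover have "sg i \<circ> (sg i \<circ> y \<circ> sg i) \<circ> sg i = y" by (simp add: fun_eq_iff)
    ultimately show ?thesis using False less Invol_conj_sg[OF y i]
      by (auto simp: invol_down_def invol_act_def)
  qed
  then show "invol_down i y \<in> Invol n" "invol_down i y i < invol_down i y (Suc i)"
    "invol_act i (invol_down i y) = y" by blast+
qed

lemma invol_act_ascent:
  assumes z: "z \<in> Invol n" and i: "i \<in> {1..<n}" and asc: "z i < z (Suc i)"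
  shows "invol_act i z \<in> Invol n" "invol_act i z (Suc i) < invol_act i z i"
    "invol_down i (invol_act i z) = z"
proof -
  note zz = InvolD(2)[OF z]
  have *: "invol_act i z \<in> Invol n \<and> invol_act i z (Suc i) < invol_act i z i \<and>
    invol_down i (invol_act i z) = z"
  proof (cases "z i = i \<and> z (Suc i) = Suc i")
    case True
    then show ?thesis using Invol_comp_sg[OF z i]
      by (auto simp: invol_down_def invol_act_def)
  next
    case False
    have less: "sg i (z i) < sg i (z (Suc i))"
      using sg_less_iff[of "z i" i "z (Suc i)"] False asc by auto
    \<comment> \<open>The conjugate does not send \<open>i\<close> to \<open>Suc i\<close>, so
      \<open>invol_down\<close> undoes it by conjugation.\<close>
    have "sg i (z (Suc i)) \<noteq> Suc i"
    proof
      assume "sg i (z (Suc i)) = Suc i"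
      then have "z (Suc i) = i" by (metis sg_simps(2,4))
      then show False using zz[of "Suc i"] asc by simp
    qed
    moreover have "sg i \<circ> (sg i \<circ> z \<circ> sg i) \<circ> sg i = z" by (simp add: fun_eq_iff)
    ultimately show ?thesis using False less Invol_conj_sg[OF z i] asc
      by (auto simp: invol_down_def invol_act_def)
  qed
  then show "invol_act i z \<in> Invol n" "invol_act i z (Suc i) < invol_act i z i"
    "invol_down i (invol_act i z) = z" by blast+
qed

text \<open>Four times the usual rank function of the Bruhat order on involutions, that is twice the
  sum of the length and the number of 2-cycles.\<close>
definition invol_rank :: "nat \<Rightarrow> (nat \<Rightarrow> nat) \<Rightarrow> nat" where
  "invol_rank n z = 2 * len n z + card {k. z k \<noteq> k}"

text \<open>Either the length grows by 1 and two fixed points become a 2-cycle, or the length grows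
  by 2 and the set of moved points is only relabelled. The weights in \<open>invol_rank\<close> make
  both contributions equal to 4.\<close>

lemma invol_rank_invol_act:
  assumes z: "z \<in> Invol n" and i: "i \<in> {1..<n}" and asc: "z i < z (Suc i)"
  shows "invol_rank n (invol_act i z) = invol_rank n z + 4"
proof (cases "z i = i \<and> z (Suc i) = Suc i")
  case True
  have "{k. z k \<noteq> k} \<subseteq> {1..n}"
    using InvolD(1)[OF z] by (auto simp: Sym_def permutes_def)
  then have fin: "finite {k. z k \<noteq> k}" by (rule finite_subset) simp
  have "(z \<circ> sg i) k \<noteq> k \<longleftrightarrow> k \<in> {i, Suc i} \<or> z k \<noteq> k" for k
    using True by (cases "k \<in> {i, Suc i}") auto
  then have "{k. (z \<circ> sg i) k \<noteq> k} = insert i (insert (Suc i) {k. z k \<noteq> k})" by blast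
  then have "card {k. (z \<circ> sg i) k \<noteq> k} = card {k. z k \<noteq> k} + 2"
    using True fin by simp
  moreover have "invol_act i z = z \<circ> sg i" using True by (simp add: invol_act_def)
  ultimately show ?thesis
    using len_comp_sg[OF InvolD(1)[OF z] i asc] unfolding invol_rank_def by presburger
next
  case False
  have zS: "z \<in> Sym n" "inv z = z" using z by (auto simp: Invol_def inv_unique_comp)
  let ?u = "z \<circ> sg i"
  have u: "?u \<in> Sym n" "inv ?u = sg i \<circ> z"
    using Sym_comp[OF zS(1) sg_in_Sym[OF i]] inv_comp_sg[OF zS(1)] zS by auto
  have less: "sg i (z i) < sg i (z (Suc i))"
    using sg_less_iff[of "z i" i "z (Suc i)"] False asc by auto
  have act: "invol_act i z = sg i \<circ> ?u" using False asc by (auto simp: invol_act_def comp_assoc)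
  have "len n (sg i \<circ> ?u) = len n (inv ?u \<circ> sg i)"
    using len_inv[of "sg i \<circ> ?u" n] inv_sg_comp[OF u(1)] Sym_comp[OF sg_in_Sym[OF i] u(1)] by simp
  also have "\<dots> = Suc (len n (inv ?u))"
    using less u Sym_inv[OF u(1)] i by (intro len_comp_sg) auto
  also have "\<dots> = len n z + 2"
    using len_inv[OF u(1)] len_comp_sg[OF zS(1) i asc] by simp
  finally have len: "len n (invol_act i z) = len n z + 2" unfolding act .
  have "k \<in> {k. invol_act i z k \<noteq> k} \<longleftrightarrow> k \<in> sg i ` {k. z k \<noteq> k}" for k
  proof
    assume "k \<in> {k. invol_act i z k \<noteq> k}"
    then have "z (sg i k) \<noteq> sg i k" unfolding act by auto
    then show "k \<in> sg i ` {k. z k \<noteq> k}" by (intro image_eqI[of _ _ "sg i k"]) auto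
  qed (auto simp: act)
  then have "{k. invol_act i z k \<noteq> k} = sg i ` {k. z k \<noteq> k}" by blast
  then have "card {k. invol_act i z k \<noteq> k} = card {k. z k \<noteq> k}"
    by (simp add: card_image inj_on_def)
  then show ?thesis using len by (simp add: invol_rank_def)
qed

lemma invol_act_cases:
  assumes "z \<in> Invol n"
  obtains "invol_act i z = z" | "z i < z (Suc i)"
proof (cases "z i < z (Suc i)")
  case False
  then have "z (Suc i) < z i" using Sym_neq_Suc[OF InvolD(1)[OF assms], of i] by simp
  then show ?thesis using that(1) by (simp add: invol_act_def)
qed (use that in blast)

subsection \<open>Atoms\<close>

context
  fixes n :: nat and x :: "nat \<Rightarrow> nat"
  assumes x: "x \<in> Invol n"
begin

lemma demazure_conj_comp_sg:
  assumes "w \<in> Sym n" "i \<in> {1..<n}" "w i < w (Suc i)"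
  shows "demazure_conj n x (w \<circ> sg i) = invol_act i (demazure_conj n x w)"
  using demazure_conj_right_act[OF x assms(1,2)] assms(3) by (simp add: right_act_def)

text \<open>Each letter of a reduced word raises the rank by 0 or 4. This bounds the length of any
  conjugator from below.\<close>

lemma invol_rank_demazure_conj_le:
  assumes "w \<in> Sym n"
  shows "invol_rank n (demazure_conj n x w) \<le> invol_rank n x + 4 * len n w"
  using assms
proof (induction rule: Sym_induct)
  case id
  show "invol_rank n (demazure_conj n x id) \<le> invol_rank n x + 4 * len n id"
    using InvolD(1)[OF x] by simp
next
  case (step w i)
  have IH: "invol_rank n (demazure_conj n x w) \<le> invol_rank n x + 4 * len n w"
    using step.IH .
  have z: "demazure_conj n x w \<in> Invol n" by (rule demazure_conj_Invol[OF x step(1)])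
  have "invol_rank n (invol_act i (demazure_conj n x w)) \<le> invol_rank n (demazure_conj n x w) + 4"
    using invol_rank_invol_act[OF z step(2)] by (cases rule: invol_act_cases[OF z, of i]) auto
  then show "invol_rank n (demazure_conj n x (w \<circ> sg i)) \<le> invol_rank n x + 4 * len n (w \<circ> sg i)"
    using IH demazure_conj_comp_sg[OF step(1-3)] len_comp_sg[OF step(1-3)] by simp
qed

text \<open>Leaving out the letters that act trivially on the involution gives a conjugator that
  attains the bound.\<close>

lemma exists_rank_tight_conjugator:
  assumes "w \<in> Sym n"
  shows "\<exists>v\<in>Sym n. demazure_conj n x v = demazure_conj n x w \<and>
    invol_rank n (demazure_conj n x w) = invol_rank n x + 4 * len n v"
  using assms
proof (induction rule: Sym_induct)
  case id
  show "\<exists>v\<in>Sym n. demazure_conj n x v = demazure_conj n x id \<and>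
    invol_rank n (demazure_conj n x id) = invol_rank n x + 4 * len n v"
    using InvolD(1)[OF x] by (intro bexI[of _ id]) auto
next
  case (step w i)
  let ?z = "demazure_conj n x w"
  obtain v where v: "v \<in> Sym n" "demazure_conj n x v = ?z"
    "invol_rank n ?z = invol_rank n x + 4 * len n v" using step.IH by blast
  have z: "?z \<in> Invol n" by (rule demazure_conj_Invol[OF x step(1)])
  have w: "demazure_conj n x (w \<circ> sg i) = invol_act i ?z"
    by (rule demazure_conj_comp_sg[OF step(1-3)])
  show "\<exists>v\<in>Sym n. demazure_conj n x v = demazure_conj n x (w \<circ> sg i) \<and>
    invol_rank n (demazure_conj n x (w \<circ> sg i)) = invol_rank n x + 4 * len n v"
  proof (cases rule: invol_act_cases[OF z, of i])
    case 1
    then show ?thesis using v w by (intro bexI[of _ v]) auto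
  next
    case 2
    \<comment> \<open>Otherwise a reduced word of \<open>v\<close> could end in \<open>i\<close>,
      which would put the conjugated involution in the image of \<open>invol_act i\<close> and give
      it a descent at \<open>i\<close>.\<close>
    have asc: "v i < v (Suc i)"
    proof (rule ccontr)
      assume no: "\<not> v i < v (Suc i)"
      let ?u = "v \<circ> sg i"
      have u: "?u \<in> Sym n" "?u i < ?u (Suc i)"
        using Sym_comp[OF v(1) sg_in_Sym[OF step(2)]] no Sym_neq_Suc[OF v(1), of i] by auto
      have "?z = invol_act i (demazure_conj n x ?u)"
        using demazure_conj_comp_sg[of ?u i, OF u(1) step(2) u(2)] v(2) by simp
      moreover have "demazure_conj n x ?u \<in> Invol n" by (rule demazure_conj_Invol[OF x u(1)])
      ultimately have "?z (Suc i) < ?z i"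
        using invol_act_ascent(2)[of "demazure_conj n x ?u" n i] step(2)
          Sym_neq_Suc[OF InvolD(1), of "demazure_conj n x ?u" n i]
        by (cases "demazure_conj n x ?u i < demazure_conj n x ?u (Suc i)") (auto simp: invol_act_def)
      with 2 show False by simp
    qed
    have "v \<circ> sg i \<in> Sym n" using Sym_comp[OF v(1) sg_in_Sym[OF step(2)]] .
    then show ?thesis
      using w v(2,3) demazure_conj_comp_sg[OF v(1) step(2) asc] len_comp_sg[OF v(1) step(2) asc]
        invol_rank_invol_act[OF z step(2) 2]
      by (intro bexI[of _ "v \<circ> sg i"]) auto
  qed
qed

text \<open>The lower bound on the length depends only on \<open>x\<close> and \<open>y\<close> and
  is attained as soon as some conjugator exists, so minimal length means equality.\<close>

lemma atoms_iff_rank: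
  assumes w: "w \<in> Sym n"
  shows "w \<in> atoms n x y \<longleftrightarrow>
    demazure_conj n x w = y \<and> invol_rank n y = invol_rank n x + 4 * len n w"
proof -
  have atoms: "w \<in> atoms n x y \<longleftrightarrow> demazure_conj n x w = y \<and>
      (\<forall>v\<in>Sym n. demazure_conj n x v = y \<longrightarrow> len n w \<le> len n v)"
    using w by (auto simp: atoms_def demazure_conjugators_def demazure_conj_def)
  show ?thesis
    using invol_rank_demazure_conj_le exists_rank_tight_conjugator[OF w] w unfolding atoms
    by (metis add_le_cancel_left antisym mult_le_cancel1 zero_less_numeral)
qed

text \<open>For \<open>id\<close> the value condition alone identifies the cycles of
  \<open>x\<close> and \<open>y\<close>; the order conditions hold because values equal
  positions.\<close>

lemma atom_pattern_id_iff:
  assumes y: "y \<in> Invol n"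
  shows "atom_pattern n x y id \<longleftrightarrow> x = y"
proof
  assume P: "atom_pattern n x y id"
  have xy: "x a = y a \<and> x (y a) = a" if "a \<in> cyc_mins n y" for a
  proof -
    have "value_cond x a (y a)" using P that by (auto simp: atom_pattern_def)
    then show ?thesis using that InvolD(2)[OF x, of a]
      by (auto simp: value_cond_def cyc_mins_def split: if_splits)
  qed
  show "x = y"
  proof
    fix a show "x a = y a"
    proof (cases "a \<in> {1..n}")
      case True
      then have "a \<in> cyc_mins n y \<or> y a \<in> cyc_mins n y"
        using InvolD(2,3)[OF y, of a] by (auto simp: cyc_mins_def)
      then show ?thesis using xy[of a] xy[of "y a"] InvolD(2)[OF y, of a] by auto
    next
      case False
      then show ?thesis using InvolD(1)[OF x] InvolD(1)[OF y] by (simp add: Sym_def permutes_def)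
    qed
  qed
next
  assume "x = y"
  then show "atom_pattern n x y id"
    by (auto simp: atom_pattern_def opair_def order_cond_def value_cond_def cyc_mins_def)
qed

text \<open>The quantifier over \<open>y\<close> is inside the induction because removing the last
  letter \<open>i\<close> of \<open>w\<close> replaces \<open>y\<close> by
  \<open>invol_down i y\<close>.\<close>

lemma atom_pattern_iff_rank:
  assumes "w \<in> Sym n"
  shows "\<forall>y\<in>Invol n. atom_pattern n x y w \<longleftrightarrow>
    demazure_conj n x w = y \<and> invol_rank n y = invol_rank n x + 4 * len n w"
  using assms
proof (induction rule: Sym_induct)
  case id
  show "\<forall>y\<in>Invol n. atom_pattern n x y id \<longleftrightarrow>
    demazure_conj n x id = y \<and> invol_rank n y = invol_rank n x + 4 * len n id"
    using InvolD(1)[OF x] atom_pattern_id_iff by auto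
next
  case (step w i)
  let ?z = "demazure_conj n x w" and ?u = "w \<circ> sg i"
  have IH: "atom_pattern n x y w \<longleftrightarrow> ?z = y \<and> invol_rank n y = invol_rank n x + 4 * len n w"
    if "y \<in> Invol n" for y using step.IH that by blast
  have u: "?u \<in> Sym n" "?u (Suc i) < ?u i"
    using Sym_comp[OF step(1) sg_in_Sym[OF step(2)]] step(3) by auto
  have conj_u: "demazure_conj n x ?u = invol_act i ?z"
    by (rule demazure_conj_comp_sg[OF step(1-3)])
  have len_u: "len n ?u = Suc (len n w)" by (rule len_comp_sg[OF step(1-3)])
  have z: "?z \<in> Invol n" by (rule demazure_conj_Invol[OF x step(1)])
  have down: "atom_pattern n x (invol_down i y) w \<longleftrightarrow> atom_pattern n x y ?u"
    if "y \<in> Invol n" "y (Suc i) < y i" for y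
    using atom_pattern_down[of y n i ?u x, OF that(1) step(2) u(1) that(2) u(2)] by simp
  show "\<forall>y\<in>Invol n. atom_pattern n x y ?u \<longleftrightarrow>
    demazure_conj n x ?u = y \<and> invol_rank n y = invol_rank n x + 4 * len n ?u"
  proof (intro ballI iffI)
    fix y assume y: "y \<in> Invol n" and P: "atom_pattern n x y ?u"
    have desc: "y (Suc i) < y i"
      by (rule atom_pattern_descent[of y n i ?u x, OF y step(2) u(2) P])
    note d = invol_down[OF y step(2) desc]
    have "?z = invol_down i y \<and>
        invol_rank n (invol_down i y) = invol_rank n x + 4 * len n w"
      using IH[OF d(1)] down[OF y desc] P by simp
    then show "demazure_conj n x ?u = y \<and> invol_rank n y = invol_rank n x + 4 * len n ?u"
      using d invol_rank_invol_act[OF d(1) step(2) d(2)] conj_u len_u by simp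
  next
    fix y assume y: "y \<in> Invol n"
      and r: "demazure_conj n x ?u = y \<and> invol_rank n y = invol_rank n x + 4 * len n ?u"
    have le: "invol_rank n ?z \<le> invol_rank n x + 4 * len n w"
      by (rule invol_rank_demazure_conj_le[OF step(1)])
    have act: "invol_act i ?z = y" using r conj_u by simp
    \<comment> \<open>A trivial last move would leave the rank of \<open>y\<close> at most
      \<open>invol_rank n x + 4 * len n w\<close>, which is 4 too small.\<close>
    then have "invol_act i ?z \<noteq> ?z" using r le len_u by auto
    then have asc: "?z i < ?z (Suc i)" using invol_act_cases[OF z] by blast
    note a = invol_act_ascent[OF z step(2) asc]
    have "invol_rank n ?z = invol_rank n x + 4 * len n w"
      using invol_rank_invol_act[OF z step(2) asc] act r len_u by simp
    then have "atom_pattern n x ?z w" using IH[OF z] by simp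
    then show "atom_pattern n x y ?u" using down[of y] a act y by simp
  qed
qed

end

theorem theorem5p12:
  fixes n :: nat and x y w :: "nat \<Rightarrow> nat"
  assumes "x \<in> Invol n" and "y \<in> Invol n" and "w \<in> Sym n"
  shows "w \<in> atoms n x y \<longleftrightarrow>
    (\<forall>a b a' b'. (a, b) \<in> Cyc n y \<and> (a', b') \<in> Cyc n y \<longrightarrow>
       (if w a < w b then (w a, w b) \<in> Cyc n x else {w a, w b} \<subseteq> Fix n x) \<and>
       (a \<le> b \<and> b < a' \<and> a' \<le> b' \<longrightarrow>
          w a < w a' \<and> w a < w b' \<and> w b < w b' \<and> w b < w a') \<and>
       (a < a' \<and> a' < b \<and> b < b' \<longrightarrow>
          w a < w a' \<and> w a < w b' \<and> w b < w b') \<and>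
       (a < a' \<and> a' < b' \<and> b' < b \<longrightarrow>
          \<not> (w b < w a' \<and> w a' < w a) \<and>
          \<not> (w b < w b' \<and> w b' < w a) \<and>
          \<not> (w a' < w a \<and> w a < w b \<and> w b < w b') \<and>
          \<not> (w a' < w b \<and> w b \<le> w a \<and> w a < w b')) \<and>
       (a < a' \<and> a' = b' \<and> b' < b \<longrightarrow>
          \<not> (w b < w a' \<and> w a' = w b' \<and> w b' < w a)))"
  using atoms_iff_rank[OF assms(1,3), of y] atom_pattern_iff_rank[OF assms(1,3)] assms(2)
    atom_pattern_iff[OF assms] unfolding order_cond_def by simp

end
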